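(* Let $m\ge 1$, $k\ge 1$, $r\ge 0$, $n\ge 1$ be integers, and let $\mathbb{A}$, $\mathbb{B}$, $\mathbb{C}$ be complex tensors of dimension $n$ and of orders $m+1$, $k+1$, $r+1$, respectively. Then, for the general tensor product, $$\mathbb{A}(\mathbb{B}\mathbb{C})=(\mathbb{A}\mathbb{B})\mathbb{C}.$$
   Context: Write $[n]=\{1,\dots,n\}$. An order $m$ dimension $n$ tensor is an array $\mathbb{A}=(a_{i_1i_2\cdots i_m})$ of complex numbers indexed by $(i_1,\dots,i_m)\in[n]^m$; an order 1 tensor is a vector and an order 2 tensor is an $n\times n$ matrix. General tensor product: if $\mathbb{A}$ has order $p\ge 2$ and $\mathbb{B}$ has order $q\ge 1$, both of dimension $n$, then $\mathbb{A}\mathbb{B}$ is the tensor of order $(p-1)(q-1)+1$ and dimension $n$ with entries $$(\mathbb{A}\mathbb{B})_{i\alpha_1\cdots\alpha_{p-1}}=\sum_{i_2,\dots,i_p=1}^n a_{ii_2\cdots i_p}\,b_{i_2\alpha_1}\cdots b_{i_p\alpha_{p-1}}\qquad(i\in[n],\ \alpha_1,\dots,\alpha_{p-1}\in[n]^{q-1}),$$ where the subscript of $\mathbb{A}\mathbb{B}$ is the concatenation of $i$ and the multi-indices $\alpha_1,\dots,\alpha_{p-1}$, and $b_{j\alpha}$ denotes $b_{jj_2\cdots j_q}$ for $\alpha=j_2\cdots j_q$. *)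

theory Defs
  imports Complex_Main "HOL-Library.FuncSet"
begin

definition tensor_index :: "nat \<Rightarrow> nat \<Rightarrow> nat list set" where
  "tensor_index n m = {is. length is = m \<and> set is \<subseteq> {1..n}}"

text \<open>A tensor carries its dimension \<open>n\<close>, its order \<open>m\<close> and its array of entries. The array is
  extensional, that is, it has a fixed dummy value off \<open>[n]\<^sup>m\<close>; so two tensors are equal iff
  they have the same dimension, the same order and the same entries on \<open>[n]\<^sup>m\<close>.\<close>

typedef tensor = "{(n :: nat, m :: nat, a :: nat list \<Rightarrow> complex). a \<in> extensional (tensor_index n m)}"
  by (rule exI[of _ "(0, 0, restrict (\<lambda>_. 0) (tensor_index 0 0))"]) simp

definition tensor_dim :: "tensor \<Rightarrow> nat" where
  "tensor_dim A = fst (Rep_tensor A)"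

definition tensor_order :: "tensor \<Rightarrow> nat" where
  "tensor_order A = fst (snd (Rep_tensor A))"

definition tensor_entry :: "tensor \<Rightarrow> nat list \<Rightarrow> complex" where
  "tensor_entry A = snd (snd (Rep_tensor A))"

definition make_tensor :: "nat \<Rightarrow> nat \<Rightarrow> (nat list \<Rightarrow> complex) \<Rightarrow> tensor" where
  "make_tensor n m a = Abs_tensor (n, m, restrict a (tensor_index n m))"

text \<open>The block \<open>\<alpha>\<^sub>l\<^sub>+\<^sub>1\<close> (blocks are numbered from 0 here) of a list that is the concatenation of
  blocks of length \<open>s\<close>; for \<open>s = 0\<close> every block is empty.\<close>

definition index_block :: "nat \<Rightarrow> nat \<Rightarrow> nat list \<Rightarrow> nat list" where
  "index_block s l is = take s (drop (l * s) is)"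

text \<open>The product is meaningful if both factors have the same dimension, \<open>A\<close> has order at least 2
  and \<open>B\<close> has order at least 1. The lemma \<open>tensor_entry_prod\<close> below is the entrywise formula in
  terms of concatenated multi-indices.\<close>

definition tensor_prod :: "tensor \<Rightarrow> tensor \<Rightarrow> tensor"  (infixl "\<odot>" 70) where
  "A \<odot> B =
    (let n = tensor_dim A; p = tensor_order A; q = tensor_order B in
      make_tensor n ((p - 1) * (q - 1) + 1)
        (\<lambda>is. \<Sum>js \<in> tensor_index n (p - 1).
           tensor_entry A (hd is # js) *
           (\<Prod>l < p - 1. tensor_entry B (js ! l # index_block (q - 1) l (tl is)))))"

lemma Rep_make_tensor:
  "Rep_tensor (make_tensor n m a) = (n, m, restrict a (tensor_index n m))"
  by (simp add: make_tensor_def Abs_tensor_inverse)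

lemma tensor_dim_make [simp]: "tensor_dim (make_tensor n m a) = n"
  and tensor_order_make [simp]: "tensor_order (make_tensor n m a) = m"
  and tensor_entry_make:
    "is \<in> tensor_index n m \<Longrightarrow> tensor_entry (make_tensor n m a) is = a is"
  by (simp_all add: tensor_dim_def tensor_order_def tensor_entry_def Rep_make_tensor)

lemma tensor_eqI:
  assumes "tensor_dim A = tensor_dim B" "tensor_order A = tensor_order B"
    and "\<And>is. is \<in> tensor_index (tensor_dim A) (tensor_order A) \<Longrightarrow>
           tensor_entry A is = tensor_entry B is"
  shows "A = B"
proof -
  have "tensor_entry X \<in> extensional (tensor_index (tensor_dim X) (tensor_order X))" for X
    using Rep_tensor[of X]
    by (auto simp: tensor_dim_def tensor_order_def tensor_entry_def)
  then have "tensor_entry A = tensor_entry B"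
    using assms by (metis extensionalityI)
  then show ?thesis
    using assms(1,2)
    by (simp add: tensor_dim_def tensor_order_def tensor_entry_def prod_eq_iff
        flip: Rep_tensor_inject)
qed

lemma tensor_dim_prod [simp]: "tensor_dim (A \<odot> B) = tensor_dim A"
  and tensor_order_prod [simp]:
    "tensor_order (A \<odot> B) = (tensor_order A - 1) * (tensor_order B - 1) + 1"
  by (simp_all add: tensor_prod_def Let_def)

lemma index_block_concat:
  assumes "\<forall>\<alpha> \<in> set \<alpha>s. length \<alpha> = s" "l < length \<alpha>s"
  shows "index_block s l (concat \<alpha>s) = \<alpha>s ! l"
  using assms
proof (induction \<alpha>s arbitrary: l)
  case Nil
  then show ?case by simp
next
  case (Cons \<alpha> \<alpha>s)
  then show ?case by (cases l) (auto simp: index_block_def)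
qed

lemma tensor_entry_prod:
  assumes "tensor_dim A = n" "tensor_order A = p" "tensor_order B = q"
    and "i \<in> {1..n}" "length \<alpha>s = p - 1" "\<forall>\<alpha> \<in> set \<alpha>s. \<alpha> \<in> tensor_index n (q - 1)"
  shows "tensor_entry (A \<odot> B) (i # concat \<alpha>s) =
    (\<Sum>js \<in> tensor_index n (p - 1).
       tensor_entry A (i # js) * (\<Prod>l < p - 1. tensor_entry B (js ! l # \<alpha>s ! l)))"
proof -
  have len: "\<forall>\<alpha> \<in> set \<alpha>s. length \<alpha> = q - 1"
    using assms(6) by (auto simp: tensor_index_def)
  have "length (concat \<alpha>s) = length \<alpha>s * (q - 1)"
    using len by (induction \<alpha>s) auto
  then have "i # concat \<alpha>s \<in> tensor_index n ((p - 1) * (q - 1) + 1)"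
    using assms(4-6) by (auto simp: tensor_index_def)
  then show ?thesis
    using assms(1-3,5) len
    by (simp add: tensor_prod_def Let_def tensor_entry_make index_block_concat)
qed

end

theory Submission
  imports Defs
begin

text \<open>Expanding the product of sums in \<open>A(BC)\<close> by distributivity, a choice of one multi-index in
  \<open>[n]\<^sup>k\<close> for each of \<open>m\<close> factors is a single multi-index in \<open>[n]\<^sup>m\<^sup>k\<close>, cut into blocks of
  length \<open>k\<close>; this is the summation multi-index of \<open>(AB)C\<close>.\<close>

lemma index_block_append:
  assumes "length xs = s"
  shows "index_block s 0 (xs @ ys) = xs"
    and "index_block s (Suc l) (xs @ ys) = index_block s l ys"
  using assms by (simp_all add: index_block_def)

lemma nth_index_block:
  assumes "t < k" "l * k + t < length is"
  shows "index_block k l is ! t = is ! (l * k + t)"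
  using assms by (simp add: index_block_def)

text \<open>Sub-block \<open>t\<close> of block \<open>l\<close> starts at position
  \<open>l * (k * r) + t * r = (l * k + t) * r\<close> of the whole list, and \<open>t < k\<close>
  keeps the end of the outer block from truncating it. This matches the arguments of
  \<open>C\<close> in the two bracketings.\<close>

lemma index_block_index_block:
  assumes "t < k"
  shows "index_block r t (index_block (k * r) l is) = index_block r (l * k + t) is"
proof -
  have "Suc t * r \<le> k * r"
    using assms by (intro mult_le_mono1) simp
  then have "r \<le> k * r - t * r"
    by simp
  then show ?thesis
    by (simp add: index_block_def drop_take min_absorb1 algebra_simps)
qed

lemma block_bound:
  fixes l m s t :: nat
  assumes "l < m" "t < s"
  shows "l * s + t < m * s"
proof -
  have "Suc l * s \<le> m * s"
    using assms(1) by (intro mult_le_mono1) simp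
  then show ?thesis
    using assms(2) by simp
qed

lemma nth_tensor_index:
  assumes "is \<in> tensor_index n m" "l < m"
  shows "is ! l \<in> {1..n}"
  using assms nth_mem by (fastforce simp: tensor_index_def)

lemma tensor_index_0 [simp]: "tensor_index n 0 = {[]}"
  by (auto simp: tensor_index_def)

lemma Cons_in_tensor_index [simp]:
  "i # is \<in> tensor_index n (Suc m) \<longleftrightarrow> i \<in> {1..n} \<and> is \<in> tensor_index n m"
  by (auto simp: tensor_index_def)

lemma index_block_in_tensor_index:
  assumes "is \<in> tensor_index n (m * s)" "l < m"
  shows "index_block s l is \<in> tensor_index n s"
proof -
  have "Suc l * s \<le> m * s"
    using assms(2) by (intro mult_le_mono1) simp
  then have "length (index_block s l is) = s"
    using assms(1) by (simp add: index_block_def tensor_index_def)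
  moreover have "set (index_block s l is) \<subseteq> set is"
    unfolding index_block_def by (meson order_trans set_drop_subset set_take_subset)
  ultimately show ?thesis
    using assms(1) by (auto simp: tensor_index_def)
qed

text \<open>Cutting after position \<open>a\<close> is inverse to concatenation. This is how the
  first block is peeled off in the induction for \<open>prod_sum_tensor_index\<close>.\<close>

lemma sum_tensor_index_add:
  "sum f (tensor_index n (a + b)) =
    (\<Sum>xs\<in>tensor_index n a. \<Sum>ys\<in>tensor_index n b. f (xs @ ys))"
proof -
  have "sum f (tensor_index n (a + b)) =
      (\<Sum>(xs, ys)\<in>tensor_index n a \<times> tensor_index n b. f (xs @ ys))"
    by (rule sum.reindex_bij_witness[of _ "\<lambda>(xs, ys). xs @ ys" "\<lambda>is. (take a is, drop a is)"])
      (auto simp: tensor_index_def dest: in_set_takeD in_set_dropD)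
  then show ?thesis
    by (simp add: sum.cartesian_product)
qed

text \<open>Distributivity, by splitting off the first factor and with it the first block of
  \<open>hs\<close>. The other factors are then renumbered, so the induction hypothesis is needed
  for the shifted family; hence \<open>f\<close> is arbitrary.\<close>

lemma prod_sum_tensor_index:
  fixes f :: "nat \<Rightarrow> nat list \<Rightarrow> 'a :: comm_semiring_1"
  shows "(\<Prod>l<m. \<Sum>ks\<in>tensor_index n k. f l ks) =
    (\<Sum>hs\<in>tensor_index n (m * k). \<Prod>l<m. f l (index_block k l hs))"
proof (induction m arbitrary: f)
  case 0
  then show ?case by simp
next
  case (Suc m)
  have "(\<Sum>hs\<in>tensor_index n (Suc m * k). \<Prod>l<Suc m. f l (index_block k l hs)) =
      (\<Sum>ks\<in>tensor_index n k. \<Sum>hs\<in>tensor_index n (m * k).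
        f 0 ks * (\<Prod>l<m. f (Suc l) (index_block k l hs)))"
    unfolding mult_Suc sum_tensor_index_add
    by (intro sum.cong refl)
      (simp add: tensor_index_def prod.lessThan_Suc_shift index_block_append del: prod.lessThan_Suc)
  also have "\<dots> = (\<Prod>l<Suc m. \<Sum>ks\<in>tensor_index n k. f l ks)"
    by (simp add: prod.lessThan_Suc_shift Suc.IH[of "\<lambda>l. f (Suc l)"] sum_product
        del: prod.lessThan_Suc)
  finally show ?case ..
qed

text \<open>The intervals \<open>{l * k..<l * k + k}\<close> for \<open>l < m\<close> tile
  \<open>{..<m * k}\<close>.\<close>

lemma prod_nat_blocks:
  fixes g :: "nat \<Rightarrow> 'a :: comm_monoid_mult"
  shows "(\<Prod>l<m. \<Prod>t<k. g (l * k + t)) = (\<Prod>u<m * k. g u)"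
proof -
  have "(\<Prod>t<k. g (l * k + t)) = prod g {l * k..<l * k + k}" for l
    using prod.shift_bounds_nat_ivl[of g 0 "l * k" k] by (simp add: atLeast0LessThan add.commute)
  then show ?thesis
    by (simp add: prod.nat_group)
qed

text \<open>Leaving the tail of the multi-index uncut, unlike in \<open>tensor_entry_prod\<close>,
  allows blocks of blocks to be simplified. Orders written as successors remove the truncated
  subtractions.\<close>

lemma tensor_entry_prod_Cons:
  assumes "tensor_dim A = n" "tensor_order A = Suc p" "tensor_order B = Suc q"
    and "i \<in> {1..n}" "is \<in> tensor_index n (p * q)"
  shows "tensor_entry (A \<odot> B) (i # is) =
    (\<Sum>js\<in>tensor_index n p.
       tensor_entry A (i # js) * (\<Prod>l<p. tensor_entry B (js ! l # index_block q l is)))"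
  using assms by (simp add: tensor_prod_def Let_def tensor_entry_make)

theorem theorem1p1:
  fixes m k r n :: nat and A B C :: tensor
  assumes "m \<ge> 1" and "k \<ge> 1" and "r \<ge> 0" and "n \<ge> 1"
    and "tensor_dim A = n" and "tensor_order A = m + 1"
    and "tensor_dim B = n" and "tensor_order B = k + 1"
    and "tensor_dim C = n" and "tensor_order C = r + 1"
  shows "A \<odot> (B \<odot> C) = (A \<odot> B) \<odot> C"
proof (rule tensor_eqI)
  note [simp] = assms(5-10)
  show "tensor_dim (A \<odot> (B \<odot> C)) = tensor_dim ((A \<odot> B) \<odot> C)"
    by simp
  show "tensor_order (A \<odot> (B \<odot> C)) = tensor_order ((A \<odot> B) \<odot> C)"
    by simp
  fix ix assume "ix \<in> tensor_index (tensor_dim (A \<odot> (B \<odot> C))) (tensor_order (A \<odot> (B \<odot> C)))"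
  then have ix: "ix \<in> tensor_index n (Suc (m * (k * r)))"
    by simp
  then obtain i x where [simp]: "ix = i # x"
    by (cases ix) (auto simp: tensor_index_def)
  from ix have i: "i \<in> {1..n}" and x: "x \<in> tensor_index n (m * (k * r))"
    by simp_all
  let ?T = "tensor_index n"
  let ?a = "tensor_entry A" and ?b = "tensor_entry B" and ?c = "tensor_entry C"
  \<comment> \<open>The entry formula holds only inside the index range, so \<open>js ! l\<close>
    has to lie in \<open>{1..n}\<close> and the block has to be a multi-index of length
    \<open>k * r\<close>. Blocks of that block are then blocks of \<open>x\<close>.\<close>
  have BC: "tensor_entry (B \<odot> C) (js ! l # index_block (k * r) l x) =
      (\<Sum>ks\<in>?T k. ?b (js ! l # ks) * (\<Prod>t<k. ?c (ks ! t # index_block r (l * k + t) x)))"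
    if "js \<in> ?T m" "l < m" for js l
    using nth_tensor_index[OF that] index_block_in_tensor_index[OF x that(2)]
    by (subst tensor_entry_prod_Cons[where n = n and p = k and q = r])
      (simp_all add: index_block_index_block)
  \<comment> \<open>Once \<open>ks\<close> is block \<open>l\<close> of \<open>hs\<close>, its entry
    \<open>t\<close> is \<open>hs ! (l * k + t)\<close>, so the double product runs over the single
    index \<open>u = l * k + t\<close>.\<close>
  have C: "(\<Prod>l<m. \<Prod>t<k. ?c (index_block k l hs ! t # index_block r (l * k + t) x)) =
      (\<Prod>u<m * k. ?c (hs ! u # index_block r u x))" if "hs \<in> ?T (m * k)" for hs
  proof -
    have "length hs = m * k"
      using that by (simp add: tensor_index_def)
    then show ?thesis
      by (simp add: nth_index_block block_bound flip: prod_nat_blocks)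
  qed
  have "tensor_entry (A \<odot> (B \<odot> C)) ix =
      (\<Sum>js\<in>?T m. ?a (i # js) * (\<Prod>l<m. \<Sum>ks\<in>?T k.
        ?b (js ! l # ks) * (\<Prod>t<k. ?c (ks ! t # index_block r (l * k + t) x))))"
    using i x by (simp add: tensor_entry_prod_Cons[where n = n and p = m and q = "k * r"] BC)
  \<comment> \<open>The \<open>m\<close> independent choices of \<open>ks\<close> merge into one
    \<open>hs\<close>, and the factors from \<open>B\<close> and \<open>C\<close> separate.\<close>
  also have "\<dots> = (\<Sum>js\<in>?T m. \<Sum>hs\<in>?T (m * k).
      ?a (i # js) * (\<Prod>l<m. ?b (js ! l # index_block k l hs)) *
        (\<Prod>u<m * k. ?c (hs ! u # index_block r u x)))"
    by (simp add: prod_sum_tensor_index prod.distrib C sum_distrib_left mult.assoc)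
  \<comment> \<open>The factors from \<open>C\<close> do not depend on \<open>js\<close>; the inner
    sum left over is the entry of \<open>A \<odot> B\<close> at \<open>i # hs\<close>.\<close>
  also have "\<dots> = (\<Sum>hs\<in>?T (m * k). (\<Sum>js\<in>?T m.
      ?a (i # js) * (\<Prod>l<m. ?b (js ! l # index_block k l hs))) *
        (\<Prod>u<m * k. ?c (hs ! u # index_block r u x)))"
    by (subst sum.swap) (simp add: sum_distrib_right)
  also have "\<dots> = tensor_entry ((A \<odot> B) \<odot> C) ix"
    using i x
    by (simp add: tensor_entry_prod_Cons[where n = n and p = "m * k" and q = r]
        tensor_entry_prod_Cons[where n = n and p = m and q = k] mult.assoc)
  finally show "tensor_entry (A \<odot> (B \<odot> C)) ix = tensor_entry ((A \<odot> B) \<odot> C) ix" .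
qed

end
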